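(* Let $N$ be a positive integer and $\alpha>0$. (i) For every $\beta>0$ and $z\in\mathbb{C}$, $$E_{\alpha,\beta}(z)=\sum_{\ell=0}^{N-1}z^\ell E_{N\alpha,\beta+\ell\alpha}(z^N).$$ (ii) For every $w>-1$, $\lambda\in\mathbb{C}$ and $t>0$, $$P_{\alpha,w}(\lambda,t)=\sum_{\ell=0}^{N-1}\lambda^\ell P_{N\alpha,w+\ell\alpha}(\lambda^N,t).$$ (iii) For every $v<\alpha$, $\lambda\in\mathbb{C}$ and $t>0$, $$R_{\alpha,v}(\lambda,t)=\sum_{\ell=0}^{N-1}\lambda^{N-\ell-1}R_{N\alpha,v+\alpha\ell}(\lambda^N,t).$$
   Context: For $\alpha,\beta>0$ and $z\in\mathbb{C}$, the Mittag-Leffler function is $E_{\alpha,\beta}(z)=\sum_{n=0}^\infty \frac{z^n}{\Gamma(\alpha n+\beta)}$. For $\lambda\in\mathbb{C}$, $\alpha>0$, $t>0$: $P_{\alpha,w}(\lambda,t)=t^wE_{\alpha,w+1}(\lambda t^\alpha)=\sum_{n=0}^\infty\frac{\lambda^n t^{\alpha n+w}}{\Gamma(\alpha n+w+1)}$ for $w>-1$, and $R_{\alpha,v}(\lambda,t)=t^{\alpha-v-1}E_{\alpha,\alpha-v}(\lambda t^\alpha)=\sum_{n=0}^\infty\frac{\lambda^n t^{\alpha(n+1)-v-1}}{\Gamma(\alpha(n+1)-v)}$ for $v<\alpha$. Convention: $0^0=1$. *)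

theory Defs
  imports "HOL-Analysis.Analysis"
begin

text \<open>
  Power series in a complex variable with real parameters.  It is meant for positive parameters,
  where every Gamma value is taken at a positive real and the series converges for all \<open>z\<close>.
  The power is the one with natural exponent, so the term at \<open>n = 0\<close> follows \<open>0 ^ 0 = 1\<close>.
\<close>

definition mittag_leffler :: "real \<Rightarrow> real \<Rightarrow> complex \<Rightarrow> complex" where
  "mittag_leffler \<alpha> \<beta> z = (\<Sum>n. z ^ n / of_real (Gamma (\<alpha> * real n + \<beta>)))"

text \<open>
  The next two are meant for \<open>\<alpha> > 0\<close> and \<open>t > 0\<close>, with \<open>w > -1\<close> and \<open>v < \<alpha>\<close> respectively.
\<close>

definition ml_P :: "real \<Rightarrow> real \<Rightarrow> complex \<Rightarrow> real \<Rightarrow> complex" where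
  "ml_P \<alpha> w c t = of_real (t powr w) * mittag_leffler \<alpha> (w + 1) (c * of_real (t powr \<alpha>))"

definition ml_R :: "real \<Rightarrow> real \<Rightarrow> complex \<Rightarrow> real \<Rightarrow> complex" where
  "ml_R \<alpha> v c t =
     of_real (t powr (\<alpha> - v - 1)) * mittag_leffler \<alpha> (\<alpha> - v) (c * of_real (t powr \<alpha>))"

end

theory Submission
  imports Defs
begin

text \<open>
  Part (i) splits the Mittag-Leffler series into blocks of length \<open>N\<close>, that is, sorts the indices
  by their residue modulo \<open>N\<close>.  Summability comes from \<open>\<Gamma>\<close> outgrowing every exponential:
  \<open>\<Gamma>(x) \<ge> (\<lfloor>x\<rfloor> - 1)!\<close> and \<open>S\<^sup>k / k! \<le> e\<^sup>S\<close>.  Parts (ii) and (iii) are part (i) at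
  \<open>z = \<lambda> t\<^sup>\<alpha>\<close>, in (iii) with the order of summation reversed.
\<close>

lemma power_div_fact_le_exp:
  fixes x :: real
  assumes "x \<ge> 0"
  shows "x ^ n / fact n \<le> exp x"
proof -
  have "(\<Sum>k\<in>{n}. x ^ k / fact k) \<le> (\<Sum>k. x ^ k / fact k)"
    using exp_converges[of x] assms
    by (intro sum_le_suminf) (auto simp: sums_iff divide_inverse mult.commute)
  also have "\<dots> = exp x"
    using exp_converges[of x] by (simp add: sums_iff divide_inverse mult.commute)
  finally show ?thesis by simp
qed

text \<open>The base \<open>S\<close> is free and the loss \<open>exp (- S)\<close> does not depend
  on \<open>x\<close>, so a large enough \<open>S\<close> beats any given geometric growth.\<close>

lemma Gamma_real_ge_powr:
  fixes x S :: real
  assumes "x \<ge> 2" and "S \<ge> 1"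
  shows "S powr (x - 2) * exp (- S) \<le> Gamma x"
proof -
  \<comment> \<open>As \<open>k + 1\<close> is the floor of \<open>x\<close>, the exponent
    \<open>x - 2\<close> is at most \<open>k\<close>, while \<open>fact k = Gamma (k + 1)\<close>
    stays below \<open>Gamma x\<close>: from \<open>k \<ge> 1\<close> the comparison takes place on
    [2, \<infinity>), where \<open>Gamma\<close> increases.\<close>
  define k where "k = nat \<lfloor>x\<rfloor> - 1"
  have k: "real k + 1 \<le> x" "x \<le> real k + 2" "k \<ge> 1"
    using assms(1) unfolding k_def by linarith+
  have "S powr (x - 2) \<le> S ^ k"
    using k assms(2) by (simp add: powr_mono flip: powr_realpow)
  also have "S ^ k \<le> exp S * fact k"
    using power_div_fact_le_exp[of S k] assms(2) by (simp add: field_simps)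
  also have "fact k = Gamma (real k + 1)"
    using Gamma_fact[of k, where 'a = real] by (simp add: add.commute)
  also have "\<dots> \<le> Gamma x"
    using Gamma_real_strict_mono[of "real k + 1" x] k by (cases "real k + 1 = x") auto
  finally show ?thesis by (simp add: exp_minus field_simps)
qed

lemma summable_mittag_leffler:
  fixes \<alpha> \<beta> :: real and z :: complex
  assumes "\<alpha> > 0"
  shows "summable (\<lambda>n. z ^ n / of_real (Gamma (\<alpha> * real n + \<beta>)))"
proof -
  \<comment> \<open>\<open>q\<close> exceeds both 1 and \<open>norm z\<close> or equals 1 when
    \<open>z = 0\<close>; then \<open>norm z / q < 1\<close> is the ratio of a geometric majorant.
    \<open>S\<close> solves \<open>S powr \<alpha> = q\<close>, which turns the Gamma bound into
    growth like \<open>q ^ n\<close>, and \<open>C\<close> collects the factors free of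
    \<open>n\<close>.\<close>
  define q where "q = 2 * norm z + 1"
  define S where "S = q powr (1 / \<alpha>)"
  define C where "C = exp S / S powr (\<beta> - 2)"
  have q: "q \<ge> 1" "norm z < q" by (auto simp: q_def add_nonneg_pos)
  have S: "S \<ge> 1" unfolding S_def using q(1) assms by (intro ge_one_powr_ge_zero) auto
  have bound: "norm (z ^ n / of_real (Gamma (\<alpha> * real n + \<beta>))) \<le> C * (norm z / q) ^ n"
    \<comment> \<open>From this index on, \<open>\<alpha> * n + \<beta> \<ge> 2\<close>, as the
      Gamma bound demands.\<close>
    if n: "n \<ge> nat \<lceil>(2 - \<beta>) / \<alpha>\<rceil>" for n
  proof -
    define x where "x = \<alpha> * real n + \<beta>"
    have "(2 - \<beta>) / \<alpha> \<le> real n" using n by linarith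
    hence x: "x \<ge> 2" unfolding x_def using assms by (simp add: field_simps)
    have "S powr (x - 2) = S powr (\<alpha> * real n) * S powr (\<beta> - 2)"
      by (simp add: x_def algebra_simps flip: powr_add)
    also have "S powr (\<alpha> * real n) = q ^ n"
      using assms q by (simp add: S_def powr_powr powr_realpow)
    finally have Gamma_ge: "q ^ n * S powr (\<beta> - 2) * exp (- S) \<le> Gamma x"
      using Gamma_real_ge_powr[OF x S] by simp
    have "norm z ^ n / Gamma x \<le> norm z ^ n / (q ^ n * S powr (\<beta> - 2) * exp (- S))"
      using Gamma_ge q S x by (intro divide_left_mono mult_pos_pos) auto
    also have "\<dots> = C * (norm z / q) ^ n"
      by (simp add: C_def exp_minus field_simps)
    finally show ?thesis
      using x by (simp add: norm_divide norm_power x_def)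
  qed
  have "summable (\<lambda>n. C * (norm z / q) ^ n)"
    using q by (intro summable_mult summable_geometric) auto
  thus ?thesis
    using bound by (rule summable_comparison_test')
qed

lemma mittag_leffler_split:
  fixes \<alpha> \<beta> :: real and z :: complex
  assumes "N > 0" and "\<alpha> > 0"
  shows "mittag_leffler \<alpha> \<beta> z =
    (\<Sum>l<N. z ^ l * mittag_leffler (real N * \<alpha>) (\<beta> + real l * \<alpha>) (z ^ N))"
proof -
  define f where "f = (\<lambda>n. z ^ n / of_real (Gamma (\<alpha> * real n + \<beta>)))"
  define g where "g = (\<lambda>l n. (z ^ N) ^ n /
    of_real (Gamma (real N * \<alpha> * real n + (\<beta> + real l * \<alpha>))) :: complex)"
  have g: "summable (g l)" for l
    unfolding g_def using assms by (intro summable_mittag_leffler) auto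
  have "f sums suminf f"
    unfolding f_def using assms(2) by (intro summable_sums summable_mittag_leffler)
  \<comment> \<open>Grouping consecutive terms of a convergent series keeps its sum; block
    \<open>n\<close> holds the indices \<open>l + n * N\<close> with \<open>l < N\<close>.\<close>
  hence "(\<lambda>n. sum f {n * N..<n * N + N}) sums suminf f"
    using assms(1) by (rule sums_group)
  moreover have "sum f {n * N..<n * N + N} = (\<Sum>l<N. z ^ l * g l n)" for n
  proof -
    have "sum f {n * N..<n * N + N} = (\<Sum>l<N. f (l + n * N))"
      using sum.shift_bounds_nat_ivl[of f 0 "n * N" N]
      by (simp add: add.commute lessThan_atLeast0)
    also have "\<dots> = (\<Sum>l<N. z ^ l * g l n)"
      by (intro sum.cong refl)
        (simp add: f_def g_def power_add algebra_simps flip: power_mult)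
    finally show ?thesis .
  qed
  \<comment> \<open>The summability of each \<open>g l\<close> lets the finite sum over residues be
    exchanged with the series; uniqueness of limits then equates the two values.\<close>
  moreover have "(\<lambda>n. \<Sum>l<N. z ^ l * g l n) sums (\<Sum>l<N. z ^ l * suminf (g l))"
    using g by (intro sums_sum sums_mult summable_sums)
  ultimately show ?thesis
    unfolding mittag_leffler_def f_def g_def by (simp add: sums_unique2)
qed

text \<open>The factor \<open>(t powr \<alpha>) ^ l\<close> from the split merges with
  \<open>t powr w\<close> into the prefactor of the \<open>l\<close>-th summand, and
  \<open>(t powr \<alpha>) ^ N = t powr (N * \<alpha>)\<close>.\<close>

lemma ml_P_split:
  fixes \<alpha> w t :: real and c :: complex
  assumes "N > 0" and "\<alpha> > 0" and "t > 0"
  shows "ml_P \<alpha> w c t =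
    (\<Sum>l<N. c ^ l * ml_P (real N * \<alpha>) (w + real l * \<alpha>) (c ^ N) t)"
  unfolding ml_P_def mittag_leffler_split[OF assms(1,2)] sum_distrib_left
  using assms(3) by (intro sum.cong refl)
    (simp add: power_mult_distrib powr_power powr_add mult_ac add_ac flip: of_real_power)

lemma ml_R_split:
  fixes \<alpha> v t :: real and c :: complex
  assumes "N > 0" and "\<alpha> > 0" and "t > 0"
  shows "ml_R \<alpha> v c t =
    (\<Sum>l<N. c ^ (N - l - 1) * ml_R (real N * \<alpha>) (v + \<alpha> * real l) (c ^ N) t)"
proof -
  have "ml_R \<alpha> v c t = (\<Sum>j<N. of_real (t powr (\<alpha> - v - 1)) * ((c * of_real (t powr \<alpha>)) ^ j *
      mittag_leffler (real N * \<alpha>) (\<alpha> - v + real j * \<alpha>) ((c * of_real (t powr \<alpha>)) ^ N)))"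
    unfolding ml_R_def mittag_leffler_split[OF assms(1,2)] sum_distrib_left ..
  also have "\<dots> = (\<Sum>j<N. c ^ j * (of_real (t powr (\<alpha> - v - 1 + real j * \<alpha>)) *
      mittag_leffler (real N * \<alpha>) (\<alpha> - v + real j * \<alpha>) (c ^ N * of_real (t powr (real N * \<alpha>)))))"
    using assms(3) by (intro sum.cong refl)
      (simp add: power_mult_distrib powr_power powr_add mult_ac flip: of_real_power)
  \<comment> \<open>Substitute \<open>j = N - 1 - l\<close>: then \<open>\<alpha> - v + j * \<alpha>
    = N * \<alpha> - (v + \<alpha> * l)\<close>, the second parameter in the \<open>l\<close>-th
    \<open>ml_R\<close>; its prefactor has this exponent minus 1.\<close>
  also have "\<dots> = (\<Sum>l<N. c ^ (N - Suc l) *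
      (of_real (t powr (\<alpha> - v - 1 + real (N - Suc l) * \<alpha>)) *
       mittag_leffler (real N * \<alpha>) (\<alpha> - v + real (N - Suc l) * \<alpha>)
         (c ^ N * of_real (t powr (real N * \<alpha>)))))"
    by (rule sum.nat_diff_reindex[symmetric])
  also have "\<dots> = (\<Sum>l<N. c ^ (N - l - 1) * ml_R (real N * \<alpha>) (v + \<alpha> * real l) (c ^ N) t)"
    by (intro sum.cong refl) (simp add: ml_R_def algebra_simps)
  finally show ?thesis .
qed

theorem theorem3p4:
  fixes N :: nat and \<alpha> :: real
  assumes "N > 0" and "\<alpha> > 0"
  shows "(\<forall>(\<beta>::real) (z::complex). \<beta> > 0 \<longrightarrow>
           mittag_leffler \<alpha> \<beta> z =
             (\<Sum>l<N. z ^ l * mittag_leffler (real N * \<alpha>) (\<beta> + real l * \<alpha>) (z ^ N)))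
       \<and> (\<forall>(w::real) (c::complex) (t::real). w > -1 \<longrightarrow> t > 0 \<longrightarrow>
           ml_P \<alpha> w c t =
             (\<Sum>l<N. c ^ l * ml_P (real N * \<alpha>) (w + real l * \<alpha>) (c ^ N) t))
       \<and> (\<forall>(v::real) (c::complex) (t::real). v < \<alpha> \<longrightarrow> t > 0 \<longrightarrow>
           ml_R \<alpha> v c t =
             (\<Sum>l<N. c ^ (N - l - 1) * ml_R (real N * \<alpha>) (v + \<alpha> * real l) (c ^ N) t))"
  by (intro conjI allI impI mittag_leffler_split ml_P_split ml_R_split assms)

end
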